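(* Let $A$ be a graded superring, $B$ a graded subring, $\alpha$ an automorphism of $A$, $\beta$ an automorphism of $B$, $\lambda\in\Lambda$, $\pi\in\mathbb{Z}_2$. If $\Phi\colon{}_AA_B\to\mathrm{HOM}^{\mathrm L}_B({}^{\beta}_{B}A^{\alpha}_{A},\{\lambda,\pi\}{}_BB_B)$ is an isomorphism of $(A,B)$-bimodules, then the map $\mathrm{tr}^{\mathrm L}:=\Phi(1_A)\colon{}^{\beta}_{B}A^{\alpha}_{B}\to\{\lambda,\pi\}{}_BB_B$ is a homomorphism of $(B,B)$-bimodules satisfying: (L3) if $\mathrm{tr}^{\mathrm L}(Aa)=0$ for some $a\in A$, then $a=0$; (L4) for every $\varphi\in\mathrm{HOM}^{\mathrm L}_B({}^{\beta}_{B}A,\{\lambda,\pi\}{}_BB)$ there exists an $a\in A$ such that $\varphi=\mathrm{tr}^{\mathrm L}\circ{}^{r}a$. Conversely, if there is a homomorphism of $(B,B)$-bimodules $\mathrm{tr}^{\mathrm L}\colon{}^{\beta}_{B}A^{\alpha}_{B}\to\{\lambda,\pi\}{}_BB_B$ satisfying (L3) and (L4), then $\mathrm{tr}^{\mathrm L}=\Phi(1_A)$ for some isomorphism of $(A,B)$-bimodules $\Phi\colon{}_AA_B\to\mathrm{HOM}^{\mathrm L}_B({}^{\beta}_{B}A^{\alpha}_{A},\{\lambda,\pi\}{}_BB_B)$.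
   Context: Fix an abelian group $\Lambda$. A graded superring is an associative unital $\Lambda\times\mathbb{Z}_2$-graded ring; subrings are graded (with the same unit), automorphisms preserve the grading, and modules and bimodules are $\Lambda\times\mathbb{Z}_2$-graded. For homogeneous $v$, $|v|\in\Lambda$ and $\bar v\in\mathbb{Z}_2$ denote its degrees; formulas involving degrees are stated for homogeneous elements and extended additively. Homomorphisms of modules and bimodules are additive maps of degree $(0,0)$ commuting strictly with the actions. Shifts: $\{\mu,\gamma\}M$ is $M$ as an abelian group, with $(\{\mu,\gamma\}M)_{\nu,\delta}=M_{\nu-\mu,\delta+\gamma}$, unchanged right action, and left action $a\cdot\{\mu,\gamma\}m=(-1)^{\gamma\bar a}\{\mu,\gamma\}(am)$. Twists: ${}^{\beta}_{B}A^{\alpha}_{A}$ is $A$ as a graded abelian group with $b\cdot x=\beta(b)x$ ($b\in B$) and $x\cdot a=x\alpha(a)$ ($a\in A$); ${}^{\beta}_{B}A^{\alpha}_{B}$ and ${}^{\beta}_{B}A$ are obtained by restricting, resp. forgetting, the right action. ${}_AA_B$, ${}_BB_B$ carry the multiplication actions. For $a\in A$, ${}^{r}a\colon A\to A$ is ${}^{r}a(x)=(-1)^{\bar a\bar x}xa$ (ordinary multiplication in $A$). $\mathrm{HOM}^{\mathrm L}_B({}^{\beta}_{B}A,\{\lambda,\pi\}{}_BB)$ is the direct sum over $(\mu,\gamma)\in\Lambda\times\mathbb{Z}_2$ of the groups of additive maps $f\colon A\to\{\lambda,\pi\}B$ of degree $(\mu,\gamma)$ with $f(\beta(b)x)=(-1)^{\gamma\bar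 b}\,b\cdot f(x)$ (action in $\{\lambda,\pi\}B$). The same group, denoted $\mathrm{HOM}^{\mathrm L}_B({}^{\beta}_{B}A^{\alpha}_{A},\{\lambda,\pi\}{}_BB_B)$, is an $(A,B)$-bimodule via $(a\cdot f)(x)=(-1)^{\bar a\bar f+\bar a\bar x}f(x\alpha(a))$ and $(f\cdot b)(x)=(-1)^{\bar b\bar x}f(x)b$. *)

theory Defs
  imports Complex_Main "HOL-Library.Z2" "HOL-Library.Product_Plus" "HOL-Library.Function_Algebras"
begin

text \<open>
  The group \<open>\<Lambda>\<close> is an arbitrary type \<open>'l\<close> of class \<open>ab_group_add\<close>, and
  \<open>\<int>\<^sub>2\<close> is the type \<open>bit\<close>. Rings have sort \<open>{ring, monoid_mult}\<close>, that is
  \<open>ring_1\<close> without \<open>0 \<noteq> 1\<close>, so that the zero ring is included.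
\<close>


section \<open>Graded abelian groups\<close>

definition decomposes :: "('d \<Rightarrow> 'm::ab_group_add set) \<Rightarrow> 'm \<Rightarrow> ('d \<Rightarrow> 'm) \<Rightarrow> bool" where
  "decomposes H x c \<longleftrightarrow>
     (\<forall>d. c d \<in> H d) \<and> finite {d. c d \<noteq> 0} \<and> x = (\<Sum>d | c d \<noteq> 0. c d)"

definition sum_of_grades :: "('d \<Rightarrow> 'm::ab_group_add set) \<Rightarrow> 'm set" where
  "sum_of_grades H = {x. \<exists>c. decomposes H x c}"

definition is_grading :: "'m::ab_group_add set \<Rightarrow> ('d \<Rightarrow> 'm set) \<Rightarrow> bool" where
  "is_grading X H \<longleftrightarrow>
     (\<forall>d. 0 \<in> H d \<and> (\<forall>x\<in>H d. \<forall>y\<in>H d. x - y \<in> H d)) \<and>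
     X = sum_of_grades H \<and>
     (\<forall>x\<in>X. \<exists>!c. decomposes H x c)"

definition components :: "('d \<Rightarrow> 'm::ab_group_add set) \<Rightarrow> 'm \<Rightarrow> 'd \<Rightarrow> 'm" where
  "components H x = (THE c. decomposes H x c)"

text \<open>
  \<open>extend_additively H F x\<close> is the additive extension to arbitrary \<open>x\<close> of a formula \<open>F d x\<close> stated
  for \<open>x\<close> homogeneous of degree \<open>d\<close>.
\<close>

definition extend_additively ::
  "('d \<Rightarrow> 'm::ab_group_add set) \<Rightarrow> ('d \<Rightarrow> 'm \<Rightarrow> 'n::ab_group_add) \<Rightarrow> 'm \<Rightarrow> 'n" where
  "extend_additively H F x = (\<Sum>d | components H x d \<noteq> 0. F d (components H x d))"

lemma extend_additively_homogeneous:
  assumes "is_grading X H" "x \<in> H d" "F d 0 = 0"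
  shows "extend_additively H F x = F d x"
proof -
  define c where "c = (\<lambda>e. if e = d then x else 0)"
  have *: "{e. c e \<noteq> 0} = (if x = 0 then {} else {d})"
    by (auto simp: c_def)
  have c: "decomposes H x c"
    unfolding decomposes_def * using assms by (auto simp: c_def is_grading_def)
  then have "x \<in> X"
    using assms(1) by (auto simp: is_grading_def sum_of_grades_def)
  then have "components H x = c"
    unfolding components_def using assms(1) c by (auto simp: is_grading_def intro!: the1_equality)
  then have "extend_additively H F x = (\<Sum>e | c e \<noteq> 0. F e (c e))"
    by (simp add: extend_additively_def)
  also have "\<dots> = F d x"
    using assms(3) unfolding * by (simp add: c_def)
  finally show ?thesis .
qed

text \<open>\<open>sgn2 \<gamma> x\<close> is \<open>(-1)\<^sup>\<gamma> x\<close>.\<close>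

definition sgn2 :: "bit \<Rightarrow> 'm::ab_group_add \<Rightarrow> 'm" where
  "sgn2 g x = (if g = 0 then x else - x)"


section \<open>Graded superrings\<close>

text \<open>That the unit has degree \<open>(0, 0)\<close> is a consequence and is not required.\<close>

definition graded_superring ::
  "('l::ab_group_add \<times> bit \<Rightarrow> 'a::{ring,monoid_mult} set) \<Rightarrow> bool" where
  "graded_superring G \<longleftrightarrow>
     is_grading UNIV G \<and> (\<forall>d e. \<forall>x\<in>G d. \<forall>y\<in>G e. x * y \<in> G (d + e))"

definition sub_grading :: "('d \<Rightarrow> 'a set) \<Rightarrow> 'a set \<Rightarrow> 'd \<Rightarrow> 'a set" where
  "sub_grading G B d = G d \<inter> B"

definition graded_subring ::
  "('l::ab_group_add \<times> bit \<Rightarrow> 'a::{ring,monoid_mult} set) \<Rightarrow> 'a set \<Rightarrow> bool" where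
  "graded_subring G B \<longleftrightarrow>
     1 \<in> B \<and> (\<forall>x\<in>B. \<forall>y\<in>B. x - y \<in> B \<and> x * y \<in> B) \<and> is_grading B (sub_grading G B)"

definition graded_aut ::
  "'a::{ring,monoid_mult} set \<Rightarrow> ('d \<Rightarrow> 'a set) \<Rightarrow> ('a \<Rightarrow> 'a) \<Rightarrow> bool" where
  "graded_aut S H \<sigma> \<longleftrightarrow>
     bij_betw \<sigma> S S \<and>
     (\<forall>x\<in>S. \<forall>y\<in>S. \<sigma> (x + y) = \<sigma> x + \<sigma> y \<and> \<sigma> (x * y) = \<sigma> x * \<sigma> y) \<and>
     \<sigma> 1 = 1 \<and>
     (\<forall>d. \<sigma> ` H d \<subseteq> H d)"


section \<open>Graded modules and bimodules\<close>

record ('l, 'r, 'm) gr_module =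
  carrier :: "'m set"
  grade :: "'l \<times> bit \<Rightarrow> 'm set"
  lact :: "'r \<Rightarrow> 'm \<Rightarrow> 'm"

record ('l, 'r, 'm, 's) gr_bimodule = "('l, 'r, 'm) gr_module" +
  ract :: "'m \<Rightarrow> 's \<Rightarrow> 'm"

text \<open>
  The scalar rings \<open>R\<close> and \<open>S\<close> are subsets of the types on which the actions are defined;
  restricting an action to a subring therefore does not change the record.
\<close>

definition bimodule_hom ::
  "'r set \<Rightarrow> 's set \<Rightarrow> ('l, 'r, 'm::ab_group_add, 's) gr_bimodule \<Rightarrow>
   ('l, 'r, 'n::ab_group_add, 's) gr_bimodule \<Rightarrow> ('m \<Rightarrow> 'n) \<Rightarrow> bool" where
  "bimodule_hom R S M N f \<longleftrightarrow>
     f ` carrier M \<subseteq> carrier N \<and>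
     (\<forall>x\<in>carrier M. \<forall>y\<in>carrier M. f (x + y) = f x + f y) \<and>
     (\<forall>d. f ` grade M d \<subseteq> grade N d) \<and>
     (\<forall>r\<in>R. \<forall>x\<in>carrier M. f (lact M r x) = lact N r (f x)) \<and>
     (\<forall>s\<in>S. \<forall>x\<in>carrier M. f (ract M x s) = ract N (f x) s)"

definition bimodule_iso ::
  "'r set \<Rightarrow> 's set \<Rightarrow> ('l, 'r, 'm::ab_group_add, 's) gr_bimodule \<Rightarrow>
   ('l, 'r, 'n::ab_group_add, 's) gr_bimodule \<Rightarrow> ('m \<Rightarrow> 'n) \<Rightarrow> bool" where
  "bimodule_iso R S M N f \<longleftrightarrow>
     bimodule_hom R S M N f \<and>
     (\<exists>g. bimodule_hom R S N M g \<and>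
          (\<forall>x\<in>carrier M. g (f x) = x) \<and> (\<forall>y\<in>carrier N. f (g y) = y))"

text \<open>
  The shift \<open>{\<mu>, \<gamma>}M\<close>, where \<open>H\<close> is the grading of the ring acting from the left.
  Its elements are those of \<open>M\<close>.
\<close>

definition shift ::
  "('l::ab_group_add \<times> bit \<Rightarrow> 'r::ab_group_add set) \<Rightarrow> 'l \<Rightarrow> bit \<Rightarrow>
   ('l, 'r, 'm::ab_group_add, 'z) gr_module_scheme \<Rightarrow> ('l, 'r, 'm, 'z) gr_module_scheme" where
  "shift H \<mu> \<gamma> M = M
     \<lparr> grade := (\<lambda>(\<nu>, \<delta>). grade M (\<nu> - \<mu>, \<delta> + \<gamma>)),
       lact := (\<lambda>a m. extend_additively H (\<lambda>(_, abar) a'. sgn2 (\<gamma> * abar) (lact M a' m)) a) \<rparr>"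

definition regular ::
  "'a::{ring,monoid_mult} set \<Rightarrow> ('l \<times> bit \<Rightarrow> 'a set) \<Rightarrow> ('l, 'a, 'a, 'a) gr_bimodule" where
  "regular S H = \<lparr> carrier = S, grade = H, lact = (*), ract = (*) \<rparr>"

definition twisted ::
  "('l \<times> bit \<Rightarrow> 'a::{ring,monoid_mult} set) \<Rightarrow> ('a \<Rightarrow> 'a) \<Rightarrow> ('a \<Rightarrow> 'a) \<Rightarrow>
   ('l, 'a, 'a, 'a) gr_bimodule" where
  "twisted G \<beta> \<alpha> =
     \<lparr> carrier = UNIV, grade = G, lact = (\<lambda>b x. \<beta> b * x), ract = (\<lambda>x a. x * \<alpha> a) \<rparr>"


section \<open>The bimodule \<open>HOM\<^sup>L\<close>\<close>

text \<open>
  Here \<open>H\<close> is the grading of the ring acting from the left on \<open>M\<close> and \<open>N\<close>. Maps on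
  \<open>carrier M\<close> are represented by functions vanishing elsewhere. Right actions play no role
  in the underlying graded group.
\<close>

definition HOM_grade ::
  "('l::ab_group_add \<times> bit \<Rightarrow> 'r set) \<Rightarrow> ('l, 'r, 'm::ab_group_add, 'y) gr_module_scheme \<Rightarrow>
   ('l, 'r, 'n::ab_group_add, 'z) gr_module_scheme \<Rightarrow> 'l \<times> bit \<Rightarrow> ('m \<Rightarrow> 'n) set" where
  "HOM_grade H M N = (\<lambda>(\<mu>, \<gamma>). {f.
     f ` carrier M \<subseteq> carrier N \<and> (\<forall>x. x \<notin> carrier M \<longrightarrow> f x = 0) \<and>
     (\<forall>x\<in>carrier M. \<forall>y\<in>carrier M. f (x + y) = f x + f y) \<and>
     (\<forall>d. f ` grade M d \<subseteq> grade N (d + (\<mu>, \<gamma>))) \<and>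
     (\<forall>\<nu> bbar. \<forall>b\<in>H (\<nu>, bbar). \<forall>x\<in>carrier M.
        f (lact M b x) = sgn2 (\<gamma> * bbar) (lact N b (f x)))})"

definition HOM ::
  "('l::ab_group_add \<times> bit \<Rightarrow> 'r set) \<Rightarrow> ('l, 'r, 'm::ab_group_add, 'y) gr_module_scheme \<Rightarrow>
   ('l, 'r, 'n::ab_group_add, 'z) gr_module_scheme \<Rightarrow> ('m \<Rightarrow> 'n) set" where
  "HOM H M N = sum_of_grades (HOM_grade H M N)"

text \<open>
  For a \<open>(B, A)\<close>-bimodule \<open>M\<close> and a \<open>(B, C)\<close>-bimodule \<open>N\<close> this is an \<open>(A, C)\<close>-bimodule;
  \<open>HB\<close>, \<open>HA\<close>, \<open>HC\<close> are the gradings of the three rings. The actions are only meaningful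
  for \<open>carrier M = UNIV\<close>, as is the case for \<open>twisted\<close>.
\<close>

definition HOM_bimodule ::
  "('l::ab_group_add \<times> bit \<Rightarrow> 'b set) \<Rightarrow> ('l \<times> bit \<Rightarrow> 'a::ab_group_add set) \<Rightarrow>
   ('l \<times> bit \<Rightarrow> 'c::ab_group_add set) \<Rightarrow>
   ('l, 'b, 'm::ab_group_add, 'a) gr_bimodule \<Rightarrow> ('l, 'b, 'n::ab_group_add, 'c) gr_bimodule \<Rightarrow>
   ('l, 'a, 'm \<Rightarrow> 'n, 'c) gr_bimodule" where
  "HOM_bimodule HB HA HC M N =
     \<lparr> carrier = HOM HB M N,
       grade = HOM_grade HB M N,
       lact = (\<lambda>a f x.
         extend_additively HA (\<lambda>(_, abar) a'.
           extend_additively (HOM_grade HB M N) (\<lambda>(_, fbar) f'.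
             extend_additively (grade M) (\<lambda>(_, xbar) x'.
               sgn2 (abar * fbar + abar * xbar) (f' (ract M x' a'))) x) f) a),
       ract = (\<lambda>f b x.
         extend_additively HC (\<lambda>(_, bbar) b'.
           extend_additively (grade M) (\<lambda>(_, xbar) x'.
             sgn2 (bbar * xbar) (ract N (f x') b')) x) b) \<rparr>"


section \<open>Traces\<close>

text \<open>\<open>rmult G a\<close> is the map \<open>\<^sup>ra\<close>.\<close>

definition rmult ::
  "('l::ab_group_add \<times> bit \<Rightarrow> 'a::{ring,monoid_mult} set) \<Rightarrow> 'a \<Rightarrow> 'a \<Rightarrow> 'a" where
  "rmult G a x =
     extend_additively G (\<lambda>(_, abar) a'. extend_additively G (\<lambda>(_, xbar) x'. sgn2 (abar * xbar) (x' * a')) x) a"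

definition trace_L3 :: "('a::{ring,monoid_mult} \<Rightarrow> 'a) \<Rightarrow> bool" where
  "trace_L3 tr \<longleftrightarrow> (\<forall>a. (\<forall>x. tr (x * a) = 0) \<longrightarrow> a = 0)"

definition trace_L4 ::
  "('l::ab_group_add \<times> bit \<Rightarrow> 'a::{ring,monoid_mult} set) \<Rightarrow> ('a \<Rightarrow> 'a) set \<Rightarrow> ('a \<Rightarrow> 'a) \<Rightarrow> bool" where
  "trace_L4 G Homs tr \<longleftrightarrow> (\<forall>\<phi>\<in>Homs. \<exists>a. \<phi> = tr \<circ> rmult G a)"

end

theory Submission
  imports Defs
begin

text \<open>
  Since \<open>1\<close> has degree \<open>(0, 0)\<close>, a morphism of left modules \<open>\<Phi>\<close> is determined by \<open>tr = \<Phi> 1\<close>, namely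
  \<open>\<Phi> c = c \<cdot> tr = tr \<circ> \<^sup>r(\<alpha> c)\<close>. Compatibility of \<open>\<Phi>\<close> with the right action of \<open>B\<close> amounts to right
  \<open>B\<close>-linearity of \<open>tr\<close>, surjectivity of \<open>\<Phi>\<close> is (L4), and injectivity is (L3), because \<open>tr\<close> preserves
  degrees and hence all conditions \<open>tr (x a) = 0\<close> can be tested on the homogeneous components of \<open>a\<close>,
  where the signs in \<open>\<^sup>ra\<close> do not matter.
\<close>

section \<open>Gradings\<close>

text \<open>Degrees stay single variables \<open>d\<close> with parity \<open>snd d\<close>, and
  sign exponents stay polynomials over \<open>bit\<close>, so that ring identities apply to them
  instead of Boolean normal forms.\<close>

declare split_paired_All [simp del] add_bit_eq_xor [simp del] mult_bit_eq_and [simp del]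

section \<open>Homogeneous decompositions and additive extension\<close>

locale grading =
  fixes X :: "'m::ab_group_add set" and H :: "'d \<Rightarrow> 'm set"
  assumes is_grading: "is_grading X H"
begin

lemma zero_mem: "0 \<in> H d"
  using is_grading by (auto simp: is_grading_def)

lemma diff_mem: "x \<in> H d \<Longrightarrow> y \<in> H d \<Longrightarrow> x - y \<in> H d"
  using is_grading by (auto simp: is_grading_def)

lemma uminus_mem: "x \<in> H d \<Longrightarrow> - x \<in> H d"
  using diff_mem[OF zero_mem, of x] by simp

lemma add_mem: "x \<in> H d \<Longrightarrow> y \<in> H d \<Longrightarrow> x + y \<in> H d"
  using diff_mem[of x d "- y"] uminus_mem by simp

lemma carrier_eq: "X = sum_of_grades H"
  using is_grading by (auto simp: is_grading_def)

lemma components_eqI: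
  assumes "decomposes H x c"
  shows "components H x = c"
proof -
  have "x \<in> X"
    using assms carrier_eq by (auto simp: sum_of_grades_def)
  then show ?thesis
    unfolding components_def using is_grading assms
    by (auto simp: is_grading_def intro!: the1_equality)
qed

lemma decomposes_components: "x \<in> X \<Longrightarrow> decomposes H x (components H x)"
  using components_eqI carrier_eq by (fastforce simp: sum_of_grades_def)

lemma components_mem: "x \<in> X \<Longrightarrow> components H x d \<in> H d"
  using decomposes_components by (auto simp: decomposes_def)

lemma finite_support: "x \<in> X \<Longrightarrow> finite {d. components H x d \<noteq> 0}"
  using decomposes_components by (auto simp: decomposes_def)

lemma sum_components: "x \<in> X \<Longrightarrow> (\<Sum>d | components H x d \<noteq> 0. components H x d) = x"
  using decomposes_components by (auto simp: decomposes_def)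

text \<open>Summation over any finite superset \<open>S\<close> of the support lets several families
  share one index set.\<close>

lemma decomposesI:
  assumes "finite S" "\<And>d. c d \<in> H d" "\<And>d. d \<notin> S \<Longrightarrow> c d = 0" "x = (\<Sum>d\<in>S. c d)"
  shows "decomposes H x c"
proof -
  have sub: "{d. c d \<noteq> 0} \<subseteq> S"
    using assms by auto
  have "(\<Sum>d | c d \<noteq> 0. c d) = (\<Sum>d\<in>S. c d)"
    by (rule sum.mono_neutral_left) (use assms sub in auto)
  then show ?thesis
    using assms finite_subset[OF sub] by (auto simp: decomposes_def)
qed

lemma decomposes_homogeneous: "x \<in> H d \<Longrightarrow> decomposes H x (\<lambda>e. if e = d then x else 0)"
  by (rule decomposesI[of "{d}"]) (auto simp: zero_mem)

lemma homogeneous_mem: "x \<in> H d \<Longrightarrow> x \<in> X"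
  using decomposes_homogeneous carrier_eq by (auto simp: sum_of_grades_def)

lemma components_homogeneous: "x \<in> H d \<Longrightarrow> components H x = (\<lambda>e. if e = d then x else 0)"
  by (simp add: components_eqI decomposes_homogeneous)

lemma decomposes_add:
  assumes "x \<in> X" "y \<in> X"
  shows "decomposes H (x + y) (\<lambda>d. components H x d + components H y d)"
proof -
  let ?c = "components H"
  let ?S = "{d. ?c x d \<noteq> 0} \<union> {d. ?c y d \<noteq> 0}"
  have fin: "finite ?S"
    using assms finite_support by simp
  have "z = (\<Sum>d\<in>?S. ?c z d)" if "z \<in> {x, y}" for z
  proof -
    have "(\<Sum>d | ?c z d \<noteq> 0. ?c z d) = (\<Sum>d\<in>?S. ?c z d)"
      using fin that by (intro sum.mono_neutral_left) auto
    then show ?thesis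
      using sum_components assms that by auto
  qed
  from this[of x] this[of y] have "x + y = (\<Sum>d\<in>?S. ?c x d + ?c y d)"
    by (simp add: sum.distrib)
  then show ?thesis
    using assms fin by (intro decomposesI[of ?S]) (auto simp: components_mem add_mem)
qed

lemma carrier_add: "x \<in> X \<Longrightarrow> y \<in> X \<Longrightarrow> x + y \<in> X"
  using decomposes_add carrier_eq by (auto simp: sum_of_grades_def)

lemma carrier_zero: "0 \<in> X"
  using homogeneous_mem zero_mem by blast

lemma carrier_sum: "(\<And>i. i \<in> I \<Longrightarrow> f i \<in> X) \<Longrightarrow> sum f I \<in> X"
  by (induction I rule: infinite_finite_induct) (auto simp: carrier_zero carrier_add)

lemma components_add:
  "x \<in> X \<Longrightarrow> y \<in> X \<Longrightarrow> components H (x + y) d = components H x d + components H y d"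
  using components_eqI[OF decomposes_add] by simp

lemma homogeneous_induct [consumes 1, case_names homogeneous add]:
  assumes "x \<in> X"
    and hom: "\<And>d y. y \<in> H d \<Longrightarrow> P y"
    and add: "\<And>y z. y \<in> X \<Longrightarrow> z \<in> X \<Longrightarrow> P y \<Longrightarrow> P z \<Longrightarrow> P (y + z)"
  shows "P x"
proof -
  \<comment> \<open>Membership in \<open>X\<close> is carried along because \<open>add\<close> asks
    for it. The empty sum is covered since 0 is homogeneous.\<close>
  have "P (\<Sum>d\<in>S. components H x d) \<and> (\<Sum>d\<in>S. components H x d) \<in> X" for S
    using assms(1) hom[OF zero_mem] hom[OF components_mem]
    by (induction S rule: infinite_finite_induct)
      (auto simp: carrier_zero carrier_add homogeneous_mem[OF components_mem] intro!: add)
  from this[of "{d. components H x d \<noteq> 0}"] show ?thesis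
    using sum_components assms(1) by simp
qed

text \<open>Reindexed along the injection \<open>g\<close>, the family becomes a decomposition of 0,
  which is unique. The map \<open>g\<close> is there because later families sit in translated
  degrees such as \<open>d + e\<close>.\<close>

lemma independent:
  assumes "finite S" "inj_on g S" "\<And>s. s \<in> S \<Longrightarrow> c s \<in> H (g s)" "(\<Sum>s\<in>S. c s) = 0" "s \<in> S"
  shows "c s = 0"
proof -
  define c' where "c' d = (if d \<in> g ` S then c (inv_into S g d) else 0)" for d
  have c'_g: "c' (g s) = c s" if "s \<in> S" for s
    using that assms(2) by (simp add: c'_def)
  have "decomposes H 0 c'"
  proof (rule decomposesI[of "g ` S"])
    show "c' d \<in> H d" for d
      using c'_g assms(3) by (cases "d \<in> g ` S") (auto simp: zero_mem c'_def)
    show "0 = (\<Sum>d\<in>g ` S. c' d)"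
      using assms(2,4) c'_g by (simp add: sum.reindex)
  qed (use assms in \<open>auto simp: c'_def\<close>)
  moreover have "decomposes H 0 (\<lambda>_. 0)"
    by (rule decomposesI[of "{}"]) (auto simp: zero_mem)
  ultimately have "c' = (\<lambda>_. 0)"
    using components_eqI by metis
  then show ?thesis
    using c'_g assms(5) by metis
qed

lemma extend_additively_superset:
  assumes "finite S" "{d. components H x d \<noteq> 0} \<subseteq> S" "\<And>d. F d 0 = 0"
  shows "extend_additively H F x = (\<Sum>d\<in>S. F d (components H x d))"
  unfolding extend_additively_def using assms by (intro sum.mono_neutral_left) auto

text \<open>Over the union of both supports, which contains the support of \<open>x + y\<close>, the
  claim splits into additivity of each \<open>F d\<close> on \<open>H d\<close>.\<close>

lemma extend_additively_add:
  assumes "x \<in> X" "y \<in> X"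
    and F: "\<And>d u v. u \<in> H d \<Longrightarrow> v \<in> H d \<Longrightarrow> F d (u + v) = F d u + F d v"
  shows "extend_additively H F (x + y) = extend_additively H F x + extend_additively H F y"
proof -
  let ?S = "{d. components H x d \<noteq> 0} \<union> {d. components H y d \<noteq> 0}"
  have F0: "F d 0 = 0" for d
    using F[OF zero_mem zero_mem, of d] by simp
  have "{d. components H (x + y) d \<noteq> 0} \<subseteq> ?S"
    using components_add assms by auto
  then show ?thesis
    using assms F0 extend_additively_superset[of ?S _ F]
    by (simp add: finite_support components_add components_mem sum.distrib)
qed

lemma extend_additively_cong:
  assumes "x \<in> X" "\<And>d u. u \<in> H d \<Longrightarrow> F d u = F' d u"
  shows "extend_additively H F x = extend_additively H F' x"
  unfolding extend_additively_def using assms components_mem by (intro sum.cong) auto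

end

text \<open>Two decompositions of one element differ by a family with sum 0 over the union of their
  supports, and \<open>indep\<close> makes this difference vanish.\<close>

lemma is_gradingI:
  fixes H :: "'d \<Rightarrow> 'm::ab_group_add set"
  assumes zero: "\<And>d. 0 \<in> H d"
    and diff: "\<And>d x y. x \<in> H d \<Longrightarrow> y \<in> H d \<Longrightarrow> x - y \<in> H d"
    and indep: "\<And>S c d. finite S \<Longrightarrow> (\<And>d. d \<in> S \<Longrightarrow> c d \<in> H d) \<Longrightarrow> (\<Sum>d\<in>S. c d) = 0 \<Longrightarrow>
      d \<in> S \<Longrightarrow> c d = 0"
  shows "is_grading (sum_of_grades H) H"
proof -
  have "c = c'" if c: "decomposes H x c" and c': "decomposes H x c'" for x c c'
  proof
    fix d
    let ?S = "{d. c d \<noteq> 0} \<union> {d. c' d \<noteq> 0}"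
    have fin: "finite ?S"
      using c c' by (auto simp: decomposes_def)
    have "(\<Sum>d | c d \<noteq> 0. c d) = (\<Sum>d\<in>?S. c d)" "(\<Sum>d | c' d \<noteq> 0. c' d) = (\<Sum>d\<in>?S. c' d)"
      using fin by (auto intro!: sum.mono_neutral_left)
    then have "(\<Sum>d\<in>?S. c d - c' d) = 0"
      using c c' by (simp add: decomposes_def sum_subtractf)
    then have "c d - c' d = 0" if "d \<in> ?S"
      using c c' that
      by (intro indep[where c = "\<lambda>d. c d - c' d", OF fin]) (auto simp: decomposes_def diff)
    then show "c d = c' d"
      by (cases "d \<in> ?S") auto
  qed
  then show ?thesis
    using zero diff unfolding is_grading_def sum_of_grades_def by blast
qed

lemma extend_additively_distrib:
  "extend_additively H (\<lambda>d x. F d x + F' d x) x = extend_additively H F x + extend_additively H F' x"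
  by (simp add: extend_additively_def sum.distrib)

section \<open>Additive maps between graded groups\<close>

lemma additive_on_sum:
  fixes f :: "'m::ab_group_add \<Rightarrow> 'n::ab_group_add"
  assumes "grading X H"
    and "\<And>x y. x \<in> X \<Longrightarrow> y \<in> X \<Longrightarrow> f (x + y) = f x + f y"
    and "\<And>i. i \<in> I \<Longrightarrow> c i \<in> X"
  shows "f (sum c I) = (\<Sum>i\<in>I. f (c i))"
proof -
  interpret grading X H by fact
  have "f 0 = 0"
    using assms(2)[OF carrier_zero carrier_zero] by simp
  then show ?thesis
    using assms(3)
    by (induction I rule: infinite_finite_induct) (auto simp: assms(2) carrier_sum)
qed

text \<open>The images of the components of \<open>x\<close> decompose \<open>f x\<close>. As
  \<open>f x\<close> is homogeneous of degree \<open>d\<close>, it equals the image of the component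
  of \<open>x\<close> in degree \<open>d\<close>, and injectivity identifies this component with
  \<open>x\<close>.\<close>

lemma graded_injective_reflects:
  fixes f :: "'m::ab_group_add \<Rightarrow> 'n::ab_group_add"
  assumes "grading X H" "grading Y K"
    and add: "\<And>x y. x \<in> X \<Longrightarrow> y \<in> X \<Longrightarrow> f (x + y) = f x + f y"
    and graded: "\<And>d x. x \<in> H d \<Longrightarrow> f x \<in> K d"
    and inj: "inj_on f X"
    and "x \<in> X" "f x \<in> K d"
  shows "x \<in> H d"
proof -
  interpret X: grading X H by fact
  interpret Y: grading Y K by fact
  let ?c = "components H x"
  have f0: "f 0 = 0"
    using add[OF X.carrier_zero X.carrier_zero] by simp
  have "f (\<Sum>e | ?c e \<noteq> 0. ?c e) = (\<Sum>e | ?c e \<noteq> 0. f (?c e))"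
    using assms X.components_mem X.homogeneous_mem by (intro additive_on_sum[of X H]) blast+
  then have "decomposes K (f x) (\<lambda>e. f (?c e))"
    using \<open>x \<in> X\<close> f0
    by (intro Y.decomposesI[of "{e. ?c e \<noteq> 0}"])
      (auto simp: X.finite_support X.sum_components X.components_mem graded)
  then have "(\<lambda>e. f (?c e)) = (\<lambda>e. if e = d then f x else 0)"
    using Y.components_eqI Y.components_homogeneous assms by metis
  then have "f x = f (?c d)"
    by metis
  then have "x = ?c d"
    using inj \<open>x \<in> X\<close> X.components_mem X.homogeneous_mem by (meson inj_onD)
  then show ?thesis
    using \<open>x \<in> X\<close> X.components_mem by metis
qed

text \<open>The inverse inherits additivity and linearity directly; that it preserves degrees comes
  from \<open>graded_injective_reflects\<close>.\<close>

lemma bij_bimodule_hom_iso: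
  assumes hom: "bimodule_hom R S M N f"
    and bij: "bij_betw f (carrier M) (carrier N)"
    and M: "grading (carrier M) (grade M)" and N: "grading (carrier N) (grade N)"
    and l: "\<And>r x. r \<in> R \<Longrightarrow> x \<in> carrier M \<Longrightarrow> lact M r x \<in> carrier M"
    and r: "\<And>s x. s \<in> S \<Longrightarrow> x \<in> carrier M \<Longrightarrow> ract M x s \<in> carrier M"
  shows "bimodule_iso R S M N f"
proof -
  interpret M: grading "carrier M" "grade M" by fact
  interpret N: grading "carrier N" "grade N" by fact
  define g where "g = inv_into (carrier M) f"
  have gf: "g (f x) = x" if "x \<in> carrier M" for x
    using that bij by (simp add: g_def bij_betw_def)
  have fg: "g y \<in> carrier M" "f (g y) = y" if "y \<in> carrier N" for y
    using that bij bij_betw_inv_into_right[OF bij]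
    by (auto simp: g_def bij_betw_def inv_into_into)
  have eq: "g y = x" if "x \<in> carrier M" "f x = y" for x y
    using gf that by auto
  have f: "f (x + y) = f x + f y" if "x \<in> carrier M" "y \<in> carrier M" for x y
    using hom that by (auto simp: bimodule_hom_def)
  have "g y \<in> grade M d" if "y \<in> grade N d" for y d
  proof (rule graded_injective_reflects[OF M N f])
    show "inj_on f (carrier M)"
      using bij by (simp add: bij_betw_def)
    show "f (g y) \<in> grade N d"
      using that fg N.homogeneous_mem by metis
    show "f x \<in> grade N e" if "x \<in> grade M e" for e x
      using hom that by (auto simp: bimodule_hom_def image_subset_iff)
    show "g y \<in> carrier M"
      using that fg N.homogeneous_mem by metis
  qed
  then have "bimodule_hom R S N M g"
    using hom fg l r M.carrier_add unfolding bimodule_hom_def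
    by (auto simp: image_subset_iff intro!: eq)
  then show ?thesis
    using hom gf fg by (auto simp: bimodule_iso_def)
qed

section \<open>Calculus of signs\<close>

lemma sgn2_0 [simp]: "sgn2 0 x = x" "sgn2 g 0 = 0"
  by (simp_all add: sgn2_def)

lemma sgn2_eq_0_iff [simp]: "sgn2 g x = 0 \<longleftrightarrow> x = 0"
  by (simp add: sgn2_def)

lemma sgn2_inject [simp]: "sgn2 g x = sgn2 g y \<longleftrightarrow> x = y"
  by (simp add: sgn2_def)

lemma sgn2_sgn2: "sgn2 g (sgn2 h x) = sgn2 (g + h) x"
  by (cases g; cases h) (auto simp: sgn2_def)

lemma sgn2_add: "sgn2 g (x + y) = sgn2 g x + sgn2 g y"
  by (simp add: sgn2_def)

lemma sgn2_mult: "sgn2 g (x * y) = sgn2 g x * y" "x * sgn2 g y = sgn2 g (x * y)"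
  for x y :: "'a::ring"
  by (simp_all add: sgn2_def)

lemma additive_sgn2:
  fixes f :: "'m::ab_group_add \<Rightarrow> 'n::ab_group_add"
  assumes "\<And>x y. f (x + y) = f x + f y"
  shows "f (sgn2 g x) = sgn2 g (f x)"
proof -
  interpret additive f by unfold_locales fact
  show ?thesis
    by (simp add: sgn2_def minus)
qed


lemma regular_simps:
  "carrier (regular S H) = S" "grade (regular S H) = H"
  "lact (regular S H) = (*)" "ract (regular S H) = (*)"
  by (simp_all add: regular_def)


section \<open>The bimodule of left linear maps\<close>

locale twisted_superring_extension =
  fixes G :: "'l::ab_group_add \<times> bit \<Rightarrow> 'a::{ring,monoid_mult} set"
    and B :: "'a set"
    and \<alpha> \<beta> :: "'a \<Rightarrow> 'a"
    and l :: 'l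
    and p :: bit
  assumes superring: "graded_superring G"
    and subring: "graded_subring G B"
    and \<alpha>: "graded_aut UNIV G \<alpha>"
    and \<beta>: "graded_aut B (sub_grading G B) \<beta>"
begin

abbreviation "H \<equiv> sub_grading G B"
abbreviation "twA \<equiv> twisted G \<beta> \<alpha>"
abbreviation "shB \<equiv> shift H l p (regular B H)"
abbreviation "Homs \<equiv> HOM H twA shB"
abbreviation "Hom_deg \<equiv> HOM_grade H twA shB"
abbreviation "Hom_bimod \<equiv> HOM_bimodule H G H twA shB"

sublocale A: grading UNIV G
  using superring by unfold_locales (simp add: graded_superring_def)

sublocale B: grading B H
  using subring by unfold_locales (simp add: graded_subring_def)

lemma mult_mem: "x \<in> G d \<Longrightarrow> y \<in> G e \<Longrightarrow> x * y \<in> G (d + e)"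
  using superring by (auto simp: graded_superring_def)

lemma H_subset: "b \<in> H d \<Longrightarrow> b \<in> G d" "b \<in> H d \<Longrightarrow> b \<in> B"
  by (auto simp: sub_grading_def)

lemma \<alpha>_add: "\<alpha> (x + y) = \<alpha> x + \<alpha> y" and \<alpha>_mult: "\<alpha> (x * y) = \<alpha> x * \<alpha> y"
  and \<alpha>_one: "\<alpha> 1 = 1" and \<alpha>_mem: "x \<in> G d \<Longrightarrow> \<alpha> x \<in> G d"
  and \<alpha>_bij: "bij \<alpha>"
  using \<alpha> by (auto simp: graded_aut_def image_subset_iff)

lemma \<beta>_add: "x \<in> B \<Longrightarrow> y \<in> B \<Longrightarrow> \<beta> (x + y) = \<beta> x + \<beta> y"
  and \<beta>_mem: "x \<in> H d \<Longrightarrow> \<beta> x \<in> H d"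
  using \<beta> by (auto simp: graded_aut_def image_subset_iff)

text \<open>This reduces later identities, one argument at a time, to homogeneous elements, where
  all signs are explicit.\<close>

lemma additive_eqI:
  fixes f g :: "'a \<Rightarrow> 'n::ab_group_add"
  assumes "\<And>x y. f (x + y) = f x + f y" "\<And>x y. g (x + y) = g x + g y"
    and "\<And>d x. x \<in> G d \<Longrightarrow> f x = g x"
  shows "f x = g x"
  using UNIV_I[of x] by (induction x rule: A.homogeneous_induct) (simp_all add: assms)

text \<open>
  The degree \<open>0\<close> component of \<open>1\<close> is a right identity on homogeneous elements, hence on \<open>1\<close>.
\<close>

lemma one_mem: "1 \<in> G 0"
proof -
  let ?c = "components G 1"
  have c: "?c d \<in> G d" for d
    by (simp add: A.components_mem)
  have "x * ?c 0 = x" if x: "x \<in> G d" for d x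
  proof -
    let ?S = "insert 0 {e. ?c e \<noteq> 0}"
    \<comment> \<open>The terms \<open>?f e\<close>, of degree \<open>d + e\<close>, add up to
      \<open>x * 1 - x = 0\<close>, so each of them vanishes. The index 0 is inserted into
      \<open>?S\<close> so that \<open>- x\<close> has its place even if
      \<open>?c 0 = 0\<close>.\<close>
    let ?f = "\<lambda>e. if e = 0 then x * ?c 0 - x else x * ?c e"
    have fin: "finite {e. ?c e \<noteq> 0}"
      by (simp add: A.finite_support)
    have "(\<Sum>e\<in>?S. ?c e) = (\<Sum>e | ?c e \<noteq> 0. ?c e)"
      by (rule sum.mono_neutral_right) (use fin in auto)
    then have one: "(\<Sum>e\<in>?S. ?c e) = 1"
      by (simp add: A.sum_components)
    have "(\<Sum>e\<in>?S. ?f e) = (\<Sum>e\<in>?S. x * ?c e - (if e = 0 then x else 0))"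
      by (rule sum.cong) auto
    also have "\<dots> = x * (\<Sum>e\<in>?S. ?c e) - x"
      using fin by (subst sum_subtractf) (simp add: sum_distrib_left del: sum.insert)
    finally have "(\<Sum>e\<in>?S. ?f e) = 0"
      unfolding one by simp
    moreover have "?f e \<in> G (d + e)" for e
      using mult_mem[OF x c, of e] x A.diff_mem by (cases "e = 0") simp_all
    ultimately have "?f 0 = 0"
      using fin by (intro A.independent[of ?S "\<lambda>e. d + e" ?f 0]) (auto simp: inj_on_def)
    then show ?thesis
      by simp
  qed
  then have "1 * ?c 0 = 1"
    by - (rule additive_eqI[of "\<lambda>x. x * ?c 0" "\<lambda>x. x"], auto simp: distrib_right)
  then show ?thesis
    using c[of 0] by simp
qed

section \<open>The twisted and the shifted bimodule, and the grading of the maps between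
  them\<close>

lemma twA_simps [simp]:
  "carrier twA = UNIV" "grade twA = G" "lact twA b x = \<beta> b * x" "ract twA x a = x * \<alpha> a"
  by (simp_all add: twisted_def)

text \<open>Written as the sum \<open>d + (- l, p)\<close>, the shift of degrees is a translation,
  hence injective as \<open>independent\<close> requires.\<close>

lemma shB_simps [simp]:
  "carrier shB = B" "grade shB d = H (d + (- l, p))" "ract shB x b = x * b"
  by (cases d; simp add: shift_def regular_def)+

lemma shB_lact_homogeneous: "b \<in> H d \<Longrightarrow> lact shB b m = sgn2 (p * snd d) (b * m)"
  by (simp add: shift_def regular_def extend_additively_homogeneous[OF B.is_grading] split_beta)

lemma shB_lact_add: "b \<in> B \<Longrightarrow> c \<in> B \<Longrightarrow> lact shB (b + c) m = lact shB b m + lact shB c m"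
  by (simp add: shift_def regular_def B.extend_additively_add split_beta distrib_right sgn2_add)

text \<open>The sign exponent has two sources: \<open>snd d * snd e\<close> from moving
  \<open>b\<close> past a map of degree \<open>d\<close>, and \<open>p * snd e\<close> from the left
  action on the shifted module.\<close>

lemma Hom_deg_iff:
  "f \<in> Hom_deg d \<longleftrightarrow> range f \<subseteq> B \<and> (\<forall>x y. f (x + y) = f x + f y) \<and>
     (\<forall>e. \<forall>x\<in>G e. f x \<in> H (e + d + (- l, p))) \<and>
     (\<forall>e. \<forall>b\<in>H e. \<forall>x. f (\<beta> b * x) = sgn2 (snd d * snd e + p * snd e) (b * f x))"
proof -
  have "(\<forall>\<nu> bbar. \<forall>b\<in>H (\<nu>, bbar). \<forall>x. f (\<beta> b * x) = sgn2 (snd d * bbar) (lact shB b (f x))) \<longleftrightarrow>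
      (\<forall>e. \<forall>b\<in>H e. \<forall>x. f (\<beta> b * x) = sgn2 (snd d * snd e + p * snd e) (b * f x))"
    unfolding split_paired_All by (simp add: shB_lact_homogeneous sgn2_sgn2)
  then show ?thesis
    by (cases d) (simp add: HOM_grade_def image_subset_iff del: add_Pair)
qed

lemma Hom_deg_add: "f \<in> Hom_deg d \<Longrightarrow> f (x + y) = f x + f y"
  by (simp add: Hom_deg_iff)

lemma Hom_deg_mem: "f \<in> Hom_deg d \<Longrightarrow> x \<in> G e \<Longrightarrow> f x \<in> H (e + d + (- l, p))"
  by (simp add: Hom_deg_iff)

lemma Hom_deg_diff:
  assumes f: "f \<in> Hom_deg d" and g: "g \<in> Hom_deg d"
  shows "f - g \<in> Hom_deg d"
  unfolding Hom_deg_iff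
proof (intro conjI allI ballI)
  have "f x \<in> B" "g x \<in> B" for x
    using f g by (auto simp: Hom_deg_iff)
  then show "range (f - g) \<subseteq> B"
    using subring by (auto simp: graded_subring_def)
  show "(f - g) x \<in> H (e + d + (- l, p))" if "x \<in> G e" for e x
    using Hom_deg_mem[OF f that] Hom_deg_mem[OF g that] B.diff_mem by simp
  show "(f - g) (\<beta> b * x) = sgn2 (snd d * snd e + p * snd e) (b * (f - g) x)"
    if "b \<in> H e" for e b x
  proof -
    have "f (\<beta> b * x) = sgn2 (snd d * snd e + p * snd e) (b * f x)"
      "g (\<beta> b * x) = sgn2 (snd d * snd e + p * snd e) (b * g x)"
      using f g that by (simp_all add: Hom_deg_iff)
    then show ?thesis
      by (simp add: sgn2_def right_diff_distrib)
  qed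
qed (simp add: Hom_deg_add[OF f] Hom_deg_add[OF g])

text \<open>Evaluated at \<open>x\<close> of degree \<open>e\<close>, the maps \<open>c d\<close>
  take values in the pairwise distinct degrees \<open>e + d + (- l, p)\<close> of \<open>B\<close>,
  where independence is known.\<close>

lemma Hom_deg_independent:
  assumes "finite S" "\<And>d. d \<in> S \<Longrightarrow> c d \<in> Hom_deg d" "(\<Sum>d\<in>S. c d) = 0" "d \<in> S"
  shows "c d = 0"
proof
  fix x
  have "c d x = 0" if x: "x \<in> G e" for e x
  proof (rule B.independent[of S "\<lambda>d. e + d + (- l, p)" "\<lambda>d. c d x"])
    have "(\<Sum>d\<in>S. c d x) = (\<Sum>d\<in>S. c d) x"
      using assms(1) by (induction S rule: finite_induct) auto
    then show "(\<Sum>d\<in>S. c d x) = 0"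
      using assms(3) by simp
  qed (use assms x Hom_deg_mem in \<open>auto simp: inj_on_def\<close>)
  then show "c d x = 0 x"
    using Hom_deg_add[OF assms(2)[OF assms(4)]] by - (rule additive_eqI[of "c d" 0], simp_all)
qed

sublocale Hom: grading Homs Hom_deg
proof
  show "is_grading Homs Hom_deg"
    unfolding HOM_def
  proof (rule is_gradingI)
    show "0 \<in> Hom_deg d" for d
      by (auto simp: Hom_deg_iff B.zero_mem B.carrier_zero)
  qed (use Hom_deg_diff Hom_deg_independent in blast)+
qed

lemma Homs_add: "f \<in> Homs \<Longrightarrow> f (x + y) = f x + f y"
  by (induction rule: Hom.homogeneous_induct) (auto simp: Hom_deg_add)

section \<open>The left and right actions on the bimodule of maps, and their additivity in each
  argument\<close>

lemma Hom_bimod_simps [simp]: "carrier Hom_bimod = Homs" "grade Hom_bimod = Hom_deg"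
  by (simp_all add: HOM_bimodule_def)

lemma Hom_lact_eq:
  "lact Hom_bimod a f x = extend_additively G (\<lambda>d a'. extend_additively Hom_deg (\<lambda>e f'.
     extend_additively G (\<lambda>k x'. sgn2 (snd d * snd e + snd d * snd k) (f' (x' * \<alpha> a'))) x) f) a"
  by (simp add: HOM_bimodule_def case_prod_unfold)

lemma Hom_lact_homogeneous:
  assumes "a \<in> G d" "f \<in> Hom_deg e" "x \<in> G k"
  shows "lact Hom_bimod a f x = sgn2 (snd d * snd e + snd d * snd k) (f (x * \<alpha> a))"
proof -
  have f0: "f 0 = 0" and \<alpha>0: "\<alpha> 0 = 0"
    using Hom_deg_add[OF assms(2), of 0 0] \<alpha>_add[of 0 0] by simp_all
  \<comment> \<open>Stated for every \<open>a'\<close> because the outermost extension needs it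
    twice: at \<open>a\<close>, and at 0 for the condition that its formula vanishes there.\<close>
  have *: "extend_additively Hom_deg (\<lambda>e f'. extend_additively G (\<lambda>k x'.
      sgn2 (snd d * snd e + snd d * snd k) (f' (x' * \<alpha> a'))) x) f =
      sgn2 (snd d * snd e + snd d * snd k) (f (x * \<alpha> a'))" for a'
    using assms f0
    by (simp add: extend_additively_homogeneous[OF Hom.is_grading]
        extend_additively_homogeneous[OF A.is_grading])
  show ?thesis
    unfolding Hom_lact_eq
    by (subst extend_additively_homogeneous[OF A.is_grading assms(1)])
      (simp_all only: *, simp_all add: f0 \<alpha>0)
qed

text \<open>The components \<open>f'\<close> of an element of \<open>Homs\<close> are additive,
  which splits \<open>f' (x' * \<alpha> (u + v))\<close>; the congruence rule confines the argument
  to such \<open>f'\<close>.\<close>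

lemma Hom_lact_add_left:
  assumes "f \<in> Homs"
  shows "lact Hom_bimod (a + b) f x = lact Hom_bimod a f x + lact Hom_bimod b f x"
  unfolding Hom_lact_eq
proof (rule A.extend_additively_add)
  fix d u v
  let ?F = "\<lambda>u e f'. extend_additively G
    (\<lambda>k x'. sgn2 (snd d * snd e + snd d * snd k) (f' (x' * \<alpha> u))) x"
  have "?F (u + v) e f' = ?F u e f' + ?F v e f'" if "f' \<in> Hom_deg e" for e f'
    using that by (simp add: \<alpha>_add distrib_left Hom_deg_add sgn2_add extend_additively_distrib)
  then have "extend_additively Hom_deg (?F (u + v)) f =
      extend_additively Hom_deg (\<lambda>e f'. ?F u e f' + ?F v e f') f"
    by (rule Hom.extend_additively_cong[OF assms])
  then show "extend_additively Hom_deg (?F (u + v)) f =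
      extend_additively Hom_deg (?F u) f + extend_additively Hom_deg (?F v) f"
    by (simp add: extend_additively_distrib)
qed auto

lemma Hom_lact_add_right:
  assumes "f \<in> Homs" "g \<in> Homs"
  shows "lact Hom_bimod a (f + g) x = lact Hom_bimod a f x + lact Hom_bimod a g x"
proof -
  let ?F = "\<lambda>d u e f'. extend_additively G
    (\<lambda>k x'. sgn2 (snd d * snd e + snd d * snd k) (f' (x' * \<alpha> u))) x"
  have "extend_additively Hom_deg (?F d u) (f + g) =
      extend_additively Hom_deg (?F d u) f + extend_additively Hom_deg (?F d u) g" for d :: "'l \<times> bit" and u
    using assms by (intro Hom.extend_additively_add) (auto simp: sgn2_add extend_additively_distrib)
  then show ?thesis
    by (simp add: Hom_lact_eq extend_additively_distrib)
qed

lemma Hom_lact_apply_add: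
  assumes "f \<in> Homs"
  shows "lact Hom_bimod a f (x + y) = lact Hom_bimod a f x + lact Hom_bimod a f y"
proof -
  let ?F = "\<lambda>x d u e f'. extend_additively G
    (\<lambda>k x'. sgn2 (snd d * snd e + snd d * snd k) (f' (x' * \<alpha> u))) x"
  have "?F (x + y) d u e f' = ?F x d u e f' + ?F y d u e f'" if "f' \<in> Hom_deg e"
    for d :: "'l \<times> bit" and u e f'
    using that by (intro A.extend_additively_add) (auto simp: distrib_right Hom_deg_add sgn2_add)
  then have "extend_additively Hom_deg (?F (x + y) d u) f =
      extend_additively Hom_deg (\<lambda>e f'. ?F x d u e f' + ?F y d u e f') f"
    for d :: "'l \<times> bit" and u
    by (rule Hom.extend_additively_cong[OF assms])
  then show ?thesis
    by (simp add: Hom_lact_eq extend_additively_distrib)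
qed

lemma Hom_ract_eq:
  "ract Hom_bimod f b x = extend_additively H (\<lambda>d b'.
     extend_additively G (\<lambda>k x'. sgn2 (snd d * snd k) (f x' * b')) x) b"
  by (simp add: HOM_bimodule_def case_prod_unfold)

lemma Hom_ract_homogeneous:
  assumes "f \<in> Homs" "b \<in> H d" "x \<in> G k"
  shows "ract Hom_bimod f b x = sgn2 (snd d * snd k) (f x * b)"
proof -
  have "f 0 = 0"
    using Homs_add[OF assms(1), of 0 0] by simp
  then show ?thesis
    using assms(2,3)
    by (simp add: Hom_ract_eq extend_additively_homogeneous[OF A.is_grading]
        extend_additively_homogeneous[OF B.is_grading])
qed

lemma Hom_ract_add_left: "ract Hom_bimod (f + g) b x = ract Hom_bimod f b x + ract Hom_bimod g b x"
  by (simp add: Hom_ract_eq distrib_right sgn2_add extend_additively_distrib)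

lemma Hom_ract_add_right:
  "b \<in> B \<Longrightarrow> c \<in> B \<Longrightarrow> ract Hom_bimod f (b + c) x = ract Hom_bimod f b x + ract Hom_bimod f c x"
  unfolding Hom_ract_eq
  by (rule B.extend_additively_add) (simp_all add: distrib_left sgn2_add extend_additively_distrib)

lemma Hom_ract_apply_add:
  assumes "f \<in> Homs"
  shows "ract Hom_bimod f b (x + y) = ract Hom_bimod f b x + ract Hom_bimod f b y"
proof -
  have "extend_additively G (\<lambda>k x'. sgn2 (snd d * snd k) (f x' * b')) (x + y) =
    extend_additively G (\<lambda>k x'. sgn2 (snd d * snd k) (f x' * b')) x +
    extend_additively G (\<lambda>k x'. sgn2 (snd d * snd k) (f x' * b')) y"
    for d :: "'l \<times> bit" and b'
    by (rule A.extend_additively_add) (simp_all add: Homs_add[OF assms] distrib_right sgn2_add)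
  then show ?thesis
    by (simp add: Hom_ract_eq extend_additively_distrib)
qed

section \<open>Signed right multiplication\<close>

lemma rmult_eq:
  "rmult G a x = extend_additively G (\<lambda>d a'.
     extend_additively G (\<lambda>k x'. sgn2 (snd d * snd k) (x' * a')) x) a"
  by (simp add: rmult_def case_prod_unfold)

lemma rmult_homogeneous: "a \<in> G d \<Longrightarrow> x \<in> G k \<Longrightarrow> rmult G a x = sgn2 (snd d * snd k) (x * a)"
  by (simp add: rmult_eq extend_additively_homogeneous[OF A.is_grading])

lemma rmult_add: "rmult G (a + b) x = rmult G a x + rmult G b x"
  unfolding rmult_eq
  by (rule A.extend_additively_add) (simp_all add: distrib_left sgn2_add extend_additively_distrib)

lemma rmult_apply_add: "rmult G a (x + y) = rmult G a x + rmult G a y"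
proof -
  have "extend_additively G (\<lambda>k x'. sgn2 (snd d * snd k) (x' * a')) (x + y) =
    extend_additively G (\<lambda>k x'. sgn2 (snd d * snd k) (x' * a')) x +
    extend_additively G (\<lambda>k x'. sgn2 (snd d * snd k) (x' * a')) y"
    for d :: "'l \<times> bit" and a'
    by (rule A.extend_additively_add) (simp_all add: distrib_right sgn2_add)
  then show ?thesis
    by (simp add: rmult_eq extend_additively_distrib)
qed


section \<open>Traces\<close>

text \<open>In degree 0 the sign \<open>snd d * snd e\<close> disappears, so
  \<open>Hom_deg 0\<close> already encodes left linearity for homogeneous scalars of
  \<open>B\<close>; induction extends it to all of \<open>B\<close>.\<close>

lemma bimodule_hom_trace_iff:
  "bimodule_hom B B twA shB tr \<longleftrightarrow>
     tr \<in> Hom_deg 0 \<and> (\<forall>b\<in>B. \<forall>x. tr (x * \<alpha> b) = tr x * b)"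
proof
  assume "bimodule_hom B B twA shB tr"
  then show "tr \<in> Hom_deg 0 \<and> (\<forall>b\<in>B. \<forall>x. tr (x * \<alpha> b) = tr x * b)"
    by (auto simp: bimodule_hom_def Hom_deg_iff image_subset_iff shB_lact_homogeneous H_subset)
next
  assume asm: "tr \<in> Hom_deg 0 \<and> (\<forall>b\<in>B. \<forall>x. tr (x * \<alpha> b) = tr x * b)"
  then have tr: "tr \<in> Hom_deg 0" ..
  have left: "tr (\<beta> b * x) = lact shB b (tr x)" if "b \<in> B" for b x
    using that
  proof (induction b rule: B.homogeneous_induct)
    case (homogeneous d b)
    then show ?case
      using tr by (simp add: Hom_deg_iff shB_lact_homogeneous)
  next
    case (add b c)
    then show ?case
      by (simp add: \<beta>_add shB_lact_add distrib_right Hom_deg_add[OF tr])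
  qed
  show "bimodule_hom B B twA shB tr"
    unfolding bimodule_hom_def twA_simps shB_simps
  proof (intro conjI allI ballI)
    show "range tr \<subseteq> B"
      using tr by (simp add: Hom_deg_iff)
    show "tr ` G d \<subseteq> H (d + (- l, p))" for d
      using Hom_deg_mem[OF tr] by fastforce
  qed (use asm left Hom_deg_add[OF tr] in blast)+
qed

text \<open>Only the degree of \<open>tr\<close> is assumed: right linearity of
  \<open>\<Phi> 1\<close> is itself derived later from facts proved here.\<close>

context
  fixes tr
  assumes tr: "tr \<in> Hom_deg 0"
begin

lemma tr_add: "tr (x + y) = tr x + tr y"
  using tr by (rule Hom_deg_add)

lemma tr_sgn2: "tr (sgn2 g x) = sgn2 g (tr x)"
  by (rule additive_sgn2) (rule tr_add)

lemma tr_sum: "tr (\<Sum>i\<in>I. f i) = (\<Sum>i\<in>I. tr (f i))"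
  by (rule additive_on_sum[OF A.grading_axioms]) (simp_all add: tr_add)

text \<open>As \<open>tr\<close> has degree 0, the left action retains only the sign
  \<open>snd d * snd k\<close>. This is also the sign of right multiplication by
  \<open>\<alpha> c\<close>, since \<alpha> preserves degrees.\<close>

lemma Hom_lact_trace: "lact Hom_bimod c tr x = tr (rmult G (\<alpha> c) x)"
proof (rule additive_eqI[of "\<lambda>c. lact Hom_bimod c tr x"])
  fix d c
  assume c: "c \<in> G d"
  show "lact Hom_bimod c tr x = tr (rmult G (\<alpha> c) x)"
  proof (rule additive_eqI[of "lact Hom_bimod c tr"])
    show "lact Hom_bimod c tr x = tr (rmult G (\<alpha> c) x)" if "x \<in> G k" for k x
      using Hom_lact_homogeneous[OF c tr that] rmult_homogeneous[OF \<alpha>_mem[OF c] that]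
      by (simp add: tr_sgn2)
  qed (simp_all add: Hom_lact_apply_add Hom.homogeneous_mem[OF tr] rmult_apply_add tr_add)
qed (simp_all add: Hom_lact_add_left Hom.homogeneous_mem[OF tr] rmult_add \<alpha>_add tr_add)

text \<open>The summands lie in distinct degrees \<open>e + d + (- l, p)\<close>, so no cancellation
  occurs whatever the signs \<open>s\<close>.\<close>

lemma trace_signed_sum_eq_0_iff:
  assumes x: "x \<in> G e"
  shows "(\<Sum>d | components G a d \<noteq> 0. sgn2 (s d) (tr (x * components G a d))) = 0 \<longleftrightarrow>
    (\<forall>d. components G a d \<noteq> 0 \<longrightarrow> tr (x * components G a d) = 0)"
proof -
  let ?c = "components G a"
  have "sgn2 (s d) (tr (x * ?c d)) \<in> H (e + d + (- l, p))" for d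
    using Hom_deg_mem[OF tr mult_mem[OF x A.components_mem]] B.uminus_mem by (auto simp: sgn2_def)
  then have "sgn2 (s d) (tr (x * ?c d)) = 0"
    if "(\<Sum>d | ?c d \<noteq> 0. sgn2 (s d) (tr (x * ?c d))) = 0" "?c d \<noteq> 0" for d
    using that A.finite_support[of a]
    by (intro B.independent[of _ "\<lambda>d. e + d + (- l, p)" "\<lambda>d. sgn2 (s d) (tr (x * ?c d))" d])
      (auto simp: inj_on_def)
  then show ?thesis
    by (auto intro!: sum.neutral)
qed

text \<open>For homogeneous \<open>x\<close> both values are sums of the terms
  \<open>tr (x * components G a d)\<close>, differing only in signs; additivity in \<open>x\<close>
  reduces the quantifiers to this case.\<close>

lemma trace_rmult_eq_0_iff: "(\<forall>x. tr (rmult G a x) = 0) \<longleftrightarrow> (\<forall>x. tr (x * a) = 0)"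
proof -
  have "tr (rmult G a x) = 0 \<longleftrightarrow> tr (x * a) = 0" if x: "x \<in> G e" for e x
  proof -
    let ?c = "components G a"
    have "tr (rmult G a x) = (\<Sum>d | ?c d \<noteq> 0. sgn2 (snd d * snd e) (tr (x * ?c d)))"
      using x unfolding rmult_eq
      by (subst extend_additively_def)
        (simp add: extend_additively_homogeneous[OF A.is_grading] tr_sum tr_sgn2)
    moreover have "tr (x * a) = (\<Sum>d | ?c d \<noteq> 0. sgn2 0 (tr (x * ?c d)))"
      by (simp add: A.sum_components flip: tr_sum sum_distrib_left)
    ultimately show ?thesis
      by (simp only: trace_signed_sum_eq_0_iff[OF x])
  qed
  moreover have "(\<forall>x. f x = 0) \<longleftrightarrow> (\<forall>d. \<forall>x\<in>G d. f x = 0)"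
    if "\<And>x y. f (x + y) = f x + f y" for f :: "'a \<Rightarrow> 'a"
    using additive_eqI[of f "\<lambda>_. 0"] that by auto
  ultimately show ?thesis
    by (simp add: tr_add rmult_apply_add distrib_right)
qed

text \<open>The candidate for \<Phi>, equal to the action of \<open>c\<close> on \<open>tr\<close>
  by \<open>trace_map_lact\<close>. In this form, (L4) becomes a statement about its range.\<close>

definition trace_map :: "'a \<Rightarrow> 'a \<Rightarrow> 'a" where
  "trace_map c = tr \<circ> rmult G (\<alpha> c)"

lemma trace_map_add: "trace_map (c + d) = trace_map c + trace_map d"
  by (simp add: fun_eq_iff trace_map_def \<alpha>_add rmult_add tr_add)

lemma trace_map_apply_add: "trace_map c (x + y) = trace_map c x + trace_map c y"
  by (simp add: trace_map_def rmult_apply_add tr_add)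

lemma trace_map_homogeneous:
  "c \<in> G d \<Longrightarrow> x \<in> G k \<Longrightarrow> trace_map c x = sgn2 (snd d * snd k) (tr (x * \<alpha> c))"
  using rmult_homogeneous[OF \<alpha>_mem] by (simp add: trace_map_def flip: tr_sgn2)

lemma trace_map_one: "trace_map 1 = tr"
proof
  show "trace_map 1 x = tr x" for x
    by (rule additive_eqI[of "trace_map 1" tr])
      (simp_all add: trace_map_apply_add tr_add trace_map_homogeneous[OF one_mem] \<alpha>_one)
qed

text \<open>Parities add in \<open>\<beta> b * x\<close>: the part \<open>snd d * snd k\<close> is
  absorbed into \<open>trace_map c x\<close>, and \<open>snd d * snd e\<close> is the sign demanded
  of a map of degree \<open>d\<close>.\<close>

lemma trace_map_mem_Hom_deg:
  assumes c: "c \<in> G d"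
  shows "trace_map c \<in> Hom_deg d"
  unfolding Hom_deg_iff
proof (intro conjI allI ballI)
  show "range (trace_map c) \<subseteq> B"
    using tr by (auto simp: trace_map_def Hom_deg_iff)
  show "trace_map c x \<in> H (e + d + (- l, p))" if "x \<in> G e" for e x
    using Hom_deg_mem[OF tr mult_mem[OF that \<alpha>_mem[OF c]]] B.uminus_mem
    by (auto simp: trace_map_homogeneous[OF c that] sgn2_def)
  show "trace_map c (\<beta> b * x) = sgn2 (snd d * snd e + p * snd e) (b * trace_map c x)"
    if b: "b \<in> H e" for e b x
  proof (rule additive_eqI[of "\<lambda>x. trace_map c (\<beta> b * x)"])
    fix k x
    assume x: "x \<in> G k"
    have "\<beta> b * x \<in> G (e + k)"
      using mult_mem[OF H_subset(1)[OF \<beta>_mem[OF b]] x] .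
    then have "trace_map c (\<beta> b * x) = sgn2 (snd d * (snd e + snd k)) (tr (\<beta> b * (x * \<alpha> c)))"
      by (simp add: trace_map_homogeneous[OF c] mult.assoc)
    also have "tr (\<beta> b * (x * \<alpha> c)) = sgn2 (p * snd e) (b * tr (x * \<alpha> c))"
      using tr b by (simp add: Hom_deg_iff)
    finally show "trace_map c (\<beta> b * x) = sgn2 (snd d * snd e + p * snd e) (b * trace_map c x)"
      by (simp add: trace_map_homogeneous[OF c x] sgn2_sgn2 sgn2_mult algebra_simps)
  qed (simp_all add: distrib_left trace_map_apply_add sgn2_add)
qed (rule trace_map_apply_add)

lemma trace_map_mem_Homs: "trace_map c \<in> Homs"
  using UNIV_I[of c]
proof (induction c rule: A.homogeneous_induct)
  case (homogeneous d c)
  then show ?case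
    by (rule Hom.homogeneous_mem[OF trace_map_mem_Hom_deg])
next
  case (add c d)
  then show ?case
    unfolding trace_map_add by (intro Hom.carrier_add)
qed

lemma trace_map_mult: "trace_map (a * c) = lact Hom_bimod a (trace_map c)"
proof
  fix x
  let ?L = "lact Hom_bimod"
  note add = trace_map_add trace_map_apply_add trace_map_mem_Homs
  have *: "trace_map (a * c) x = ?L a (trace_map c) x" if c: "c \<in> G e" and a: "a \<in> G d" for a c d e
  proof (rule additive_eqI[of "trace_map (a * c)"])
    fix k x
    assume x: "x \<in> G k"
    \<comment> \<open>Modulo 2 the two products of \<open>snd d\<close> and \<open>snd e\<close>
      cancel: one comes from \<open>a\<close> acting on a map of degree \<open>e\<close>, the other
      from evaluating \<open>trace_map c\<close> at \<open>x * \<alpha> a\<close>.\<close>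
    have sign: "snd d * snd e + snd d * snd k + snd e * (snd k + snd d) = (snd d + snd e) * snd k"
      by (cases "snd d"; cases "snd e"; cases "snd k") simp_all
    show "trace_map (a * c) x = ?L a (trace_map c) x"
      using sign
      by (simp add: Hom_lact_homogeneous[OF a trace_map_mem_Hom_deg[OF c] x] \<alpha>_mult sgn2_sgn2
          trace_map_homogeneous[OF mult_mem[OF a c] x]
          trace_map_homogeneous[OF c mult_mem[OF x \<alpha>_mem[OF a]]] mult.assoc)
  qed (simp_all add: add Hom_lact_apply_add)
  have "trace_map (a * c) x = ?L a (trace_map c) x" if c: "c \<in> G e" for a c e
    using *[OF c] by - (rule additive_eqI[of "\<lambda>a. trace_map (a * c) x" "\<lambda>a. ?L a (trace_map c) x"],
      simp_all add: add distrib_right Hom_lact_add_left)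
  then show "trace_map (a * c) x = ?L a (trace_map c) x"
    by - (rule additive_eqI[of "\<lambda>c. trace_map (a * c) x" "\<lambda>c. ?L a (trace_map c) x"],
      simp_all add: add distrib_left Hom_lact_add_right)
qed

text \<open>On homogeneous elements the sign of \<open>c * b\<close> against \<open>x\<close> is the
  product of the signs of \<open>c\<close> and \<open>b\<close>, and \<open>right\<close> pulls
  \<open>b\<close> out of \<open>tr\<close>.\<close>

lemma trace_map_mult_right:
  assumes right: "\<And>b x. b \<in> B \<Longrightarrow> tr (x * \<alpha> b) = tr x * b" and "b \<in> B"
  shows "trace_map (c * b) = ract Hom_bimod (trace_map c) b"
proof
  fix x
  let ?R = "ract Hom_bimod"
  note add = trace_map_add trace_map_apply_add trace_map_mem_Homs
  have *: "trace_map (c * b) x = ?R (trace_map c) b x" if c: "c \<in> G d" and b: "b \<in> H e" for b c d e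
  proof (rule additive_eqI[of "trace_map (c * b)"])
    show "trace_map (c * b) x = ?R (trace_map c) b x" if x: "x \<in> G k" for k x
      using right[OF H_subset(2)[OF b], of "x * \<alpha> c"]
      by (simp add: Hom_ract_homogeneous[OF trace_map_mem_Homs b x] \<alpha>_mult trace_map_homogeneous[OF c x]
          trace_map_homogeneous[OF mult_mem[OF c H_subset(1)[OF b]] x] sgn2_sgn2 algebra_simps
          flip: sgn2_mult)
  qed (simp_all add: add Hom_ract_apply_add)
  have "trace_map (c * b) x = ?R (trace_map c) b x" if b: "b \<in> H e" for b c e
    using *[OF _ b] by - (rule additive_eqI[of "\<lambda>c. trace_map (c * b) x" "\<lambda>c. ?R (trace_map c) b x"],
      simp_all add: add distrib_right Hom_ract_add_left)
  with \<open>b \<in> B\<close> show "trace_map (c * b) x = ?R (trace_map c) b x"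
    by (induction b rule: B.homogeneous_induct)
      (simp_all add: add distrib_left Hom_ract_add_right)
qed

text \<open>At homogeneous \<open>x\<close> both sides of \<open>eq\<close> carry the same sign
  \<open>snd d * snd k\<close>, which cancels.\<close>

lemma trace_right_linear:
  assumes eq: "\<And>b. b \<in> B \<Longrightarrow> trace_map b = ract Hom_bimod tr b" and "b \<in> B"
  shows "tr (x * \<alpha> b) = tr x * b"
  using \<open>b \<in> B\<close>
proof (induction b rule: B.homogeneous_induct)
  case (homogeneous d b)
  show ?case
  proof (rule additive_eqI[of "\<lambda>x. tr (x * \<alpha> b)"])
    show "tr (x * \<alpha> b) = tr x * b" if x: "x \<in> G k" for k x
      using fun_cong[OF eq[OF H_subset(2)[OF homogeneous]], of x]
      by (simp add: trace_map_homogeneous[OF H_subset(1)[OF homogeneous] x]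
          Hom_ract_homogeneous[OF Hom.homogeneous_mem[OF tr] homogeneous x])
  qed (simp_all add: distrib_right tr_add)
qed (simp add: \<alpha>_add distrib_left tr_add)

lemma trace_map_lact: "lact Hom_bimod c tr = trace_map c"
  by (simp add: fun_eq_iff Hom_lact_trace trace_map_def)

lemma trace_map_eq_0_iff: "trace_map c = 0 \<longleftrightarrow> (\<forall>x. tr (x * \<alpha> c) = 0)"
  using trace_rmult_eq_0_iff by (simp add: fun_eq_iff trace_map_def)

text \<open>Since \<alpha> is surjective, the element \<open>a\<close> in (L3) can be written
  \<open>\<alpha> c\<close>, and \<open>\<alpha> c = 0\<close> only for
  \<open>c = 0\<close>.\<close>

lemma trace_L3_iff: "trace_L3 tr \<longleftrightarrow> (\<forall>c. trace_map c = 0 \<longrightarrow> c = 0)"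
proof -
  have "\<alpha> c = 0 \<longleftrightarrow> c = 0" for c
    using \<alpha>_bij \<alpha>_add[of 0 0] by (metis add_cancel_left_left bij_is_inj injD)
  moreover have "trace_L3 tr \<longleftrightarrow> (\<forall>c. (\<forall>x. tr (x * \<alpha> c) = 0) \<longrightarrow> \<alpha> c = 0)"
    unfolding trace_L3_def using \<alpha>_bij by (metis bij_pointE)
  ultimately show ?thesis
    by (simp add: trace_map_eq_0_iff)
qed

text \<open>Surjectivity of \<alpha> again replaces \<open>a\<close> by
  \<open>\<alpha> c\<close>.\<close>

lemma trace_L4_iff: "trace_L4 G Homs tr \<longleftrightarrow> Homs \<subseteq> range trace_map"
  unfolding trace_L4_def trace_map_def using \<alpha>_bij by (auto simp: image_iff) (metis bij_pointE)+

end

section \<open>Passage between isomorphisms and traces\<close>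

lemma trace_of_iso:
  assumes iso: "bimodule_iso UNIV B (regular UNIV G) Hom_bimod \<Phi>"
  shows "bimodule_hom B B twA shB (\<Phi> 1)" "trace_L3 (\<Phi> 1)" "trace_L4 G Homs (\<Phi> 1)"
proof -
  obtain g where g: "\<And>x. g (\<Phi> x) = x" "\<And>f. f \<in> Homs \<Longrightarrow> \<Phi> (g f) = f"
    using iso by (auto simp: bimodule_iso_def regular_simps)
  have hom: "\<Phi> (x + y) = \<Phi> x + \<Phi> y" "x \<in> G d \<Longrightarrow> \<Phi> x \<in> Hom_deg d"
    "\<Phi> (a * x) = lact Hom_bimod a (\<Phi> x)" "b \<in> B \<Longrightarrow> \<Phi> (x * b) = ract Hom_bimod (\<Phi> x) b"
    for x y a b d
    using iso by (auto simp: bimodule_iso_def bimodule_hom_def regular_simps image_subset_iff)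
  have tr: "\<Phi> 1 \<in> Hom_deg 0"
    using hom(2) one_mem .
  have \<Phi>: "\<Phi> = trace_map (\<Phi> 1)"
    using hom(3)[of _ 1] by (simp add: fun_eq_iff trace_map_lact[OF tr])
  \<comment> \<open>Writing \<open>b\<close> as \<open>1 * b\<close> gives the right translate of
    \<open>\<Phi> 1\<close>, while \<open>b * 1\<close> gave \<open>trace_map (\<Phi> 1) b\<close>;
    their equality is the premise of \<open>trace_right_linear\<close>.\<close>
  have "\<Phi> b = ract Hom_bimod (\<Phi> 1) b" if "b \<in> B" for b
    using hom(4)[of b 1] that by simp
  then show "bimodule_hom B B twA shB (\<Phi> 1)"
    using tr \<Phi> trace_right_linear[OF tr] by (auto simp: bimodule_hom_trace_iff)
  have "\<Phi> 0 = 0"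
    using hom(1)[of 0 0] by simp
  then show "trace_L3 (\<Phi> 1)"
    unfolding trace_L3_iff[OF tr] using \<Phi> g(1) by metis
  show "trace_L4 G Homs (\<Phi> 1)"
    unfolding trace_L4_iff[OF tr] using \<Phi> g(2) by (metis rangeI subsetI)
qed

lemma iso_of_trace:
  assumes hom: "bimodule_hom B B twA shB tr" and "trace_L3 tr" "trace_L4 G Homs tr"
  shows "bimodule_iso UNIV B (regular UNIV G) Hom_bimod (trace_map tr)"
proof -
  have tr: "tr \<in> Hom_deg 0" and right: "\<And>b x. b \<in> B \<Longrightarrow> tr (x * \<alpha> b) = tr x * b"
    using hom by (simp_all add: bimodule_hom_trace_iff)
  interpret \<Phi>: additive "trace_map tr"
    by unfold_locales (rule trace_map_add[OF tr])
  have "inj (trace_map tr)"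
  proof (rule injI)
    fix x y
    assume "trace_map tr x = trace_map tr y"
    \<comment> \<open>Additivity turns injectivity into triviality of the kernel, which is
      (L3).\<close>
    then have "trace_map tr (x - y) = 0"
      by (simp add: \<Phi>.diff)
    then show "x = y"
      using assms(2) trace_L3_iff[OF tr] by fastforce
  qed
  moreover have "range (trace_map tr) = Homs"
    using assms(3) trace_L4_iff[OF tr] trace_map_mem_Homs[OF tr] by auto
  ultimately have bij: "bij_betw (trace_map tr) UNIV Homs"
    by (simp add: bij_betw_def)
  have "bimodule_hom UNIV B (regular UNIV G) Hom_bimod (trace_map tr)"
    unfolding bimodule_hom_def regular_simps Hom_bimod_simps
  proof (intro conjI allI ballI)
    show "range (trace_map tr) \<subseteq> Homs"
      using trace_map_mem_Homs[OF tr] by auto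
    show "trace_map tr ` G d \<subseteq> Hom_deg d" for d
      using trace_map_mem_Hom_deg[OF tr] by blast
    show "trace_map tr (x * b) = ract Hom_bimod (trace_map tr x) b" if "b \<in> B" for x b
      using trace_map_mult_right[OF tr right that] .
  qed (simp_all only: \<Phi>.add trace_map_mult[OF tr])
  then show ?thesis
    using bij A.grading_axioms Hom.grading_axioms
    by - (rule bij_bimodule_hom_iso, simp_all add: regular_simps)
qed

end

theorem proposition4p1:
  fixes G :: "'l::ab_group_add \<times> bit \<Rightarrow> 'a::{ring,monoid_mult} set"
    and B :: "'a set"
    and \<alpha> \<beta> :: "'a \<Rightarrow> 'a"
    and l :: 'l
    and p :: bit
  defines "H \<equiv> sub_grading G B"
  defines "AB \<equiv> regular UNIV G"
    and "twA \<equiv> twisted G \<beta> \<alpha>"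
    and "shB \<equiv> shift H l p (regular B H)"
  assumes "graded_superring G"
    and "graded_subring G B"
    and "graded_aut UNIV G \<alpha>"
    and "graded_aut B H \<beta>"
  shows "(\<forall>\<Phi>. bimodule_iso UNIV B AB (HOM_bimodule H G H twA shB) \<Phi> \<longrightarrow>
            bimodule_hom B B twA shB (\<Phi> 1) \<and>
            trace_L3 (\<Phi> 1) \<and> trace_L4 G (HOM H twA shB) (\<Phi> 1)) \<and>
         (\<forall>tr. bimodule_hom B B twA shB tr \<and>
            trace_L3 tr \<and> trace_L4 G (HOM H twA shB) tr \<longrightarrow>
            (\<exists>\<Phi>. bimodule_iso UNIV B AB (HOM_bimodule H G H twA shB) \<Phi> \<and> tr = \<Phi> 1))"
proof -
  interpret twisted_superring_extension G B \<alpha> \<beta> l p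
    using assms(5-) by unfold_locales (simp_all add: H_def)
  \<comment> \<open>For the converse the witness is \<open>trace_map tr\<close>, whose value at 1 is
    \<open>tr\<close> by \<open>trace_map_one\<close>.\<close>
  show ?thesis
    unfolding H_def AB_def twA_def shB_def
    using trace_of_iso iso_of_trace trace_map_one bimodule_hom_trace_iff by metis
qed

end
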